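(* Consider the principal problem (see context) with a finite model set $\mathcal M=\{H_1,\dots,H_N\}$. Assume there exist - a positive integer $\tau$, - matrices $P^s_{ij,k}=P^s_{ji,k}\in\mathbb S^{n_z}$ for $i,j,k=1,\dots,N$ and $s=1,\dots,\tau$, - positive semidefinite matrices $P_{ij}=P_{ji}\in\mathbb S^{n_z}$ for $i,j=1,\dots,N$, - gain matrices $K_1,\dots,K_N\in\mathbb R^{n_u\times n_z}$, such that the inequalities $P^\tau_{ij,k}\preceq P_{jk}$, $$\begin{bmatrix}P^1_{ij,k}&0\\0&0\end{bmatrix}\succeq\mathcal G\bigl(P_{ij},K_k,(H_i+H_j)/2\bigr),\qquad \begin{bmatrix}P^{s+1}_{ij,k}&0\\0&0\end{bmatrix}\succeq\mathcal G\bigl(P^s_{ij,k},K_k,(H_i+H_j)/2\bigr)$$ hold for all $s=1,\dots,\tau-1$ and all $i,j,k=1,\dots,N$ except for $i\ne j=k$. Then the value approximation $$\bar V(z,r)=\max_{i,j}\Bigl\{|z|^2_{P_{ij}}+\tfrac12\bigl(r(H_i)+r(H_j)\bigr)\Bigr\}$$ together with the $\tau$-periodic certainty-equivalence control law $\bar\eta$ given by $$k(n\tau)=\arg\max_{i\in\{1,\dots,N\}}r_{n\tau}(H_i),\qquad u_{n\tau+s}=-K_{k(n\tau)}z_{n\tau+s},\quad s=0,\dots,\tau-1,\ n=0,1,\dots$$ (any selection if the maximum is not unique) fulfills the periodic Bellman inequality $\bar{\mathcal B}_{\bar\eta,\tau}\bar V\le\bar V$. Furthermore, $\bar\eta$ achieves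 an objective value $\sup_{H\in\mathcal M,d,T\ge 0}\sum_{t=0}^{T-1}\sigma_H(z_t,u_t,d_t)$ no greater than $$\max\Bigl\{z_0^{\mathsf T}Z_{ij}z_0+\tfrac12\bigl(r_0(H_i)+r_0(H_j)\bigr):\ Z_{ij}\in\{P_{ij}\}\cup\{P^s_{ij,k}\},\ i,j,k\in\{1,\dots,N\},\ s\in\{1,\dots,\tau-1\}\Bigr\},$$ where $r_0=0$.
   Context: Notation: $\mathbb S^n$ is the space of real symmetric $n\times n$ matrices; $|z|_P^2=z^{\mathsf T}Pz$. For a symmetric block matrix $H$, $\sigma_H(x_1,\dots,x_m)=\sum_{i,j}x_i^{\mathsf T}H^{ij}x_j$. For $H$ with blocks indexed by $z,u,d$ and $H^{dd}$ invertible, $H/H^{dd}$ is the Schur complement, with $(a,b)$ block $H^{ab}-H^{ad}(H^{dd})^{-1}H^{db}$, $a,b\in\{z,u\}$. Principal problem. Data: $\hat A\in\mathbb R^{n_z\times n_z}$, $\hat B\in\mathbb R^{n_z\times n_u}$, $\hat G\in\mathbb R^{n_z\times n_d}$, $z_0\in\mathbb R^{n_z}$, and a compact set $\mathcal M\subset\mathbb S^{n_z+n_u+n_d}$ whose members satisfy $H^{dd}\prec 0$, $H/H^{dd}\succeq 0$, $[H/H^{dd}]^{uu}\succ 0$. Dynamics: $z_{t+1}=\hat Az_t+\hat Bu_t+\hat Gd_t$; the controller chooses $u_t$ from $z_0,\dots,z_t,u_0,\dots,u_{t-1},d_0,\dots,d_{t-1}$; the adversary chooses $H\in\mathcal M$,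 $d$ and the horizon $T$ to maximize $\sum_{t=0}^{T-1}\sigma_H(z_t,u_t,d_t)$. Information state: $r_t(H)=\sum_{s=0}^{t-1}\sigma_H(z_s,u_s,d_s)$ for $H\in\mathcal M$, $r_{t+1}=f(r_t,z_t,u_t,d_t)$ with $f(r,z,u,d)(H)=r(H)+\sigma_H(z,u,d)$. Operators: for a function $V$ of $(z,r)\in\mathbb R^{n_z}\times\mathbb R^{\mathcal M}$, $\mathcal B_uV(z,r)=\sup_dV(\hat Az+\hat Bu+\hat Gd,f(r,z,u,d))$, and for a control law $\eta:(z,r)\mapsto u$, $\mathcal B_\eta V(z,r)=\mathcal B_{\eta(z,r)}V(z,r)$. For the periodic law above, $\bar{\mathcal B}_{\bar\eta,\tau}V(z,r)=(\mathcal B_{\bar\eta_k})^\tau V(z,r)$, where $k$ is the selected element of $\arg\max_ir(H_i)$ for the given $(z,r)$ (held fixed throughout the $\tau$ compositions) and $\bar\eta_k(z',r')=-K_kz'$. $\mathcal G(P,K,H)=\begin{bmatrix}\hat A-\hat BK&\hat G\end{bmatrix}^{\mathsf T}P\begin{bmatrix}\hat A-\hat BK&\hat G\end{bmatrix}+\begin{bmatrix}I&0\\-K&0\\0&I\end{bmatrix}^{\mathsf T}H\begin{bmatrix}I&0\\-K&0\\0&I\end{bmatrix}\in\mathbb S^{n_z+n_d}$. *)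

theory Defs
  imports "HOL-Analysis.Analysis"
begin

definition quad :: "real^'n^'n \<Rightarrow> real^'n \<Rightarrow> real" where
  "quad P z = z \<bullet> (P *v z)"

definition sym_mat :: "real^'n^'n \<Rightarrow> bool" where
  "sym_mat P \<longleftrightarrow> transpose P = P"

definition pos_semidef :: "real^'n^'n \<Rightarrow> bool" where
  "pos_semidef P \<longleftrightarrow> sym_mat P \<and> (\<forall>x. 0 \<le> quad P x)"

definition pos_def :: "real^'n^'n \<Rightarrow> bool" where
  "pos_def P \<longleftrightarrow> sym_mat P \<and> (\<forall>x. x \<noteq> 0 \<longrightarrow> 0 < quad P x)"

definition loewner_le :: "real^'n^'n \<Rightarrow> real^'n^'n \<Rightarrow> bool" (infix "\<preceq>" 50) where
  "P \<preceq> Q \<longleftrightarrow> pos_semidef (Q - P)"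

definition hcat :: "real^'a^'c \<Rightarrow> real^'b^'c \<Rightarrow> real^('a+'b)^'c" where
  "hcat M N = (\<chi> i j. case j of Inl a \<Rightarrow> M $ i $ a | Inr b \<Rightarrow> N $ i $ b)"

definition vcat :: "real^'c^'a \<Rightarrow> real^'c^'b \<Rightarrow> real^'c^('a+'b)" where
  "vcat M N = (\<chi> i. case i of Inl a \<Rightarrow> M $ a | Inr b \<Rightarrow> N $ b)"

text \<open>
  A model is a matrix with blocks indexed by $z$, $u$, $d$; note that
  \<open>'z + 'u + 'd\<close> stands for \<open>'z + ('u + 'd)\<close>.
\<close>

type_synonym ('z, 'u, 'd) model = "real^('z+'u+'d)^('z+'u+'d)"

abbreviation blz :: "'z \<Rightarrow> 'z + 'u + 'd" where "blz \<equiv> Inl"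
abbreviation blu :: "'u \<Rightarrow> 'z + 'u + 'd" where "blu \<equiv> \<lambda>j. Inr (Inl j)"
abbreviation bld :: "'d \<Rightarrow> 'z + 'u + 'd" where "bld \<equiv> \<lambda>j. Inr (Inr j)"

definition block :: "real^'n^'n \<Rightarrow> ('a \<Rightarrow> 'n) \<Rightarrow> ('b \<Rightarrow> 'n) \<Rightarrow> real^'b^'a" where
  "block H f g = (\<chi> i j. H $ f i $ g j)"

definition sigma ::
  "('z::finite, 'u::finite, 'd::finite) model \<Rightarrow> real^'z \<Rightarrow> real^'u \<Rightarrow> real^'d \<Rightarrow> real" where
  "sigma H z u d =
     z \<bullet> (block H blz blz *v z) + z \<bullet> (block H blz blu *v u) + z \<bullet> (block H blz bld *v d) +
     u \<bullet> (block H blu blz *v z) + u \<bullet> (block H blu blu *v u) + u \<bullet> (block H blu bld *v d) +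
     d \<bullet> (block H bld blz *v z) + d \<bullet> (block H bld blu *v u) + d \<bullet> (block H bld bld *v d)"

definition schur_block ::
  "('z::finite, 'u::finite, 'd::finite) model \<Rightarrow>
   ('a \<Rightarrow> 'z+'u+'d) \<Rightarrow> ('b \<Rightarrow> 'z+'u+'d) \<Rightarrow> real^'b^'a" where
  "schur_block H f g =
     block H f g - block H f bld ** matrix_inv (block H bld bld) ** block H bld g"

definition schur :: "('z::finite, 'u::finite, 'd::finite) model \<Rightarrow> real^('z+'u)^('z+'u)" where
  "schur H = vcat (hcat (schur_block H blz blz) (schur_block H blz blu))
                  (hcat (schur_block H blu blz) (schur_block H blu blu))"

definition admissible_model :: "('z::finite, 'u::finite, 'd::finite) model \<Rightarrow> bool" where
  "admissible_model H \<longleftrightarrow>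
     sym_mat H \<and> pos_def (- block H bld bld) \<and>
     pos_semidef (schur H) \<and> pos_def (schur_block H blu blu)"

definition lmi_G ::
  "real^'z^'z \<Rightarrow> real^'u^'z \<Rightarrow> real^'d^'z \<Rightarrow> real^'z^'z \<Rightarrow> real^'z^'u \<Rightarrow>
   ('z::finite, 'u::finite, 'd::finite) model \<Rightarrow> real^('z+'d)^('z+'d)" where
  "lmi_G A B G P K H =
     (let L = hcat (A - B ** K) G;
          S = vcat (hcat (mat 1) 0) (vcat (hcat (- K) 0) (hcat 0 (mat 1)))
      in transpose L ** P ** L + transpose S ** H ** S)"

definition pad :: "real^'z^'z \<Rightarrow> real^('z::finite+'d::finite)^('z+'d)" where
  "pad P = vcat (hcat P 0) (hcat 0 0)"

text \<open>
  An element $r$ of $\mathbb R^{\mathcal M}$ is represented by a total function on models; its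
  values outside $\mathcal M$ are irrelevant. Value functions are extended-real valued, since the
  suprema below may be infinite.
\<close>

type_synonym ('z, 'u, 'd) info = "('z, 'u, 'd) model \<Rightarrow> real"
type_synonym ('z, 'u, 'd) vfun = "real^'z \<Rightarrow> ('z, 'u, 'd) info \<Rightarrow> ereal"

definition info_step ::
  "('z::finite, 'u::finite, 'd::finite) info \<Rightarrow> real^'z \<Rightarrow> real^'u \<Rightarrow> real^'d \<Rightarrow>
   ('z, 'u, 'd) info" where
  "info_step r z u d = (\<lambda>H. r H + sigma H z u d)"

definition bellman_u ::
  "real^'z^'z \<Rightarrow> real^'u^'z \<Rightarrow> real^'d^'z \<Rightarrow> real^'u \<Rightarrow>
   ('z::finite, 'u::finite, 'd::finite) vfun \<Rightarrow> ('z, 'u, 'd) vfun" where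
  "bellman_u A B G u V z r = (SUP d. V (A *v z + B *v u + G *v d) (info_step r z u d))"

definition bellman_law ::
  "real^'z^'z \<Rightarrow> real^'u^'z \<Rightarrow> real^'d^'z \<Rightarrow>
   (real^'z \<Rightarrow> ('z, 'u, 'd) info \<Rightarrow> real^'u) \<Rightarrow>
   ('z::finite, 'u::finite, 'd::finite) vfun \<Rightarrow> ('z, 'u, 'd) vfun" where
  "bellman_law A B G \<eta> V z r = bellman_u A B G (\<eta> z r) V z r"

definition best_index :: "nat \<Rightarrow> (nat \<Rightarrow> 'm) \<Rightarrow> ('m \<Rightarrow> real) \<Rightarrow> nat \<Rightarrow> bool" where
  "best_index N H r k \<longleftrightarrow> is_arg_max (\<lambda>i. r (H i)) (\<lambda>i. i \<in> {1..N}) k"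

text \<open>The index \<open>sel z r\<close> is held fixed throughout the \<open>\<tau>\<close> compositions.\<close>

definition periodic_bellman ::
  "real^'z^'z \<Rightarrow> real^'u^'z \<Rightarrow> real^'d^'z \<Rightarrow> (nat \<Rightarrow> real^'z^'u) \<Rightarrow>
   (real^'z \<Rightarrow> ('z, 'u, 'd) info \<Rightarrow> nat) \<Rightarrow> nat \<Rightarrow>
   ('z::finite, 'u::finite, 'd::finite) vfun \<Rightarrow> ('z, 'u, 'd) vfun" where
  "periodic_bellman A B G K sel \<tau> V z r =
     (bellman_law A B G (\<lambda>z' r'. - (K (sel z r) *v z')) ^^ \<tau>) V z r"

definition value_approx ::
  "nat \<Rightarrow> (nat \<Rightarrow> ('z::finite, 'u::finite, 'd::finite) model) \<Rightarrow> (nat \<Rightarrow> nat \<Rightarrow> real^'z^'z) \<Rightarrow>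
   ('z, 'u, 'd) vfun" where
  "value_approx N H P z r =
     ereal (Max ((\<lambda>(i, j). quad (P i j) z + (r (H i) + r (H j)) / 2) ` ({1..N} \<times> {1..N})))"

text \<open>
  At time $t$ a controller maps the lists $z_0,\dots,z_t$; $u_0,\dots,u_{t-1}$;
  $d_0,\dots,d_{t-1}$ to $u_t$.
\<close>

type_synonym ('z, 'u, 'd) controller =
  "(real^'z) list \<Rightarrow> (real^'u) list \<Rightarrow> (real^'d) list \<Rightarrow> real^'u"

primrec history ::
  "real^'z^'z \<Rightarrow> real^'u^'z \<Rightarrow> real^'d^'z \<Rightarrow> ('z::finite, 'u::finite, 'd::finite) controller \<Rightarrow>
   real^'z \<Rightarrow> (nat \<Rightarrow> real^'d) \<Rightarrow> nat \<Rightarrow> (real^'z) list \<times> (real^'u) list" where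
  "history A B G \<mu> z0 d 0 = ([z0], [])"
| "history A B G \<mu> z0 d (Suc t) =
     (let (zs, us) = history A B G \<mu> z0 d t;
          u = \<mu> zs us (map d [0..<t])
      in (zs @ [A *v last zs + B *v u + G *v d t], us @ [u]))"

definition info_of ::
  "(real^'z) list \<Rightarrow> (real^'u) list \<Rightarrow> (real^'d) list \<Rightarrow>
   ('z::finite, 'u::finite, 'd::finite) info" where
  "info_of zs us ds = (\<lambda>H. \<Sum>s<length ds. sigma H (zs ! s) (us ! s) (ds ! s))"

definition objective_value ::
  "real^'z^'z \<Rightarrow> real^'u^'z \<Rightarrow> real^'d^'z \<Rightarrow> ('z::finite, 'u::finite, 'd::finite) model set \<Rightarrow>
   real^'z \<Rightarrow> ('z, 'u, 'd) controller \<Rightarrow> ereal" where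
  "objective_value A B G \<M> z0 \<mu> =
     (SUP (H, d, T) \<in> \<M> \<times> UNIV \<times> UNIV.
        let (zs, us) = history A B G \<mu> z0 d T
        in ereal (\<Sum>t<T. sigma H (zs ! t) (us ! t) (d t)))"

text \<open>
  The periodic certainty-equivalence controller evaluates the selection only on the history
  available at the start $n\tau$ of the current period. Ties may be resolved using that whole
  history.
\<close>

definition periodic_ce_controller ::
  "(nat \<Rightarrow> real^'z^'u) \<Rightarrow>
   ((real^'z) list \<Rightarrow> (real^'u) list \<Rightarrow> (real^'d) list \<Rightarrow> nat) \<Rightarrow> nat \<Rightarrow>
   ('z::finite, 'u::finite, 'd::finite) controller" where
  "periodic_ce_controller K \<kappa> \<tau> zs us ds =
     (let m = (length ds div \<tau>) * \<tau>
      in - (K (\<kappa> (take (Suc m) zs) (take m us) (take m ds)) *v last zs))"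

end

theory Submission
  imports Defs
begin

text \<open>
  Evaluated at a stacked vector \<open>(z, d)\<close>, each matrix inequality is a
  one-step dissipation inequality: along \<open>u = - K\<^sub>k z\<close> the quadratic form of the next state plus
  the stage cost averaged over the two models \<open>H\<^sub>i\<close> and \<open>H\<^sub>j\<close> is at most the next quadratic form at
  the current state (\<open>quad_lmi_G\<close>). Since the information state enters the value function only
  through \<open>(r(H\<^sub>i) + r(H\<^sub>j)) / 2\<close>, which grows by exactly this averaged cost, the inequality passes
  to the maximum over pairs, uniformly in the disturbance (\<open>value_approx_step\<close>).

  The triples \<open>i \<noteq> j = k\<close>, for which no inequality is assumed, inherit the one-step inequalities by
  swapping \<open>i\<close> and \<open>j\<close>, since all matrices are symmetric in these two indices. Their exclusion
  matters for \<open>Ps \<tau> i j k \<preceq> P j k\<close>, which closes a period by trading the pair \<open>(i, j)\<close> for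
  \<open>(j, k)\<close>. As \<open>k\<close> maximises \<open>r\<close>, replacing \<open>i\<close> by \<open>k\<close> can only increase \<open>(r(H\<^sub>i) + r(H\<^sub>j)) / 2\<close>;
  and for a pair that contains \<open>k\<close> and another index, ordering it as \<open>(k, j)\<close> makes the trade keep
  the pair, so that a comparison with \<open>P k k\<close> is never required there. This gives the periodic
  Bellman inequality (\<open>bellman_period\<close>).

  For the objective value, fix the adversary's model, disturbance and horizon. Admissibility gives
  nonnegative Schur complements, so in every state some disturbance makes the stage cost of the
  chosen model nonnegative (\<open>admissible_sigma_nonneg\<close>). The adversary can therefore prolong the
  game to the end of some period without loss (\<open>prolong_horizon\<close>). At the end of a period
  the accumulated cost is at most the value approximation, because the diagonal \<open>P\<^sub>i\<^sub>i\<close> are positive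
  semidefinite, and the Bellman inequality carries this bound back to time zero period by period.
  There it is the maximum over the choices \<open>Z = P i j\<close>, which are among those of the claimed bound.
\<close>

section \<open>Block vectors and quadratic forms\<close>

definition stack :: "real^'a \<Rightarrow> real^'b \<Rightarrow> real^('a+'b)" where
  "stack x y = (\<chi> i. case i of Inl a \<Rightarrow> x $ a | Inr b \<Rightarrow> y $ b)"

lemma sum_sum_type:
  fixes f :: "'a::finite + 'b::finite \<Rightarrow> real"
  shows "(\<Sum>i\<in>UNIV. f i) = (\<Sum>a\<in>UNIV. f (Inl a)) + (\<Sum>b\<in>UNIV. f (Inr b))"
  by (subst UNIV_Plus_UNIV[symmetric], subst sum.Plus) (simp_all del: UNIV_Plus_UNIV)

lemma inner_stack:
  fixes x x' :: "real^'a::finite" and y y' :: "real^'b::finite"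
  shows "stack x y \<bullet> stack x' y' = x \<bullet> x' + y \<bullet> y'"
  by (simp add: inner_vec_def stack_def sum_sum_type)

lemma hcat_mult_stack:
  fixes M :: "real^'a::finite^'c" and N :: "real^'b::finite^'c"
  shows "hcat M N *v stack x y = M *v x + N *v y"
  by (simp add: hcat_def stack_def matrix_vector_mult_def sum_sum_type vec_eq_iff)

lemma vcat_mult:
  fixes M :: "real^'c::finite^'a" and N :: "real^'c^'b"
  shows "vcat M N *v x = stack (M *v x) (N *v x)"
  by (simp add: vcat_def stack_def matrix_vector_mult_def vec_eq_iff split: sum.split)

lemma matrix_minus_mult:
  fixes M :: "real^'a::finite^'b"
  shows "(- M) *v x = - (M *v x)"
  by (simp add: matrix_vector_mult_def vec_eq_iff sum_negf)

lemma matrix_mult_minus: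
  fixes M :: "real^'a::finite^'b"
  shows "M *v (- x) = - (M *v x)"
  by (simp add: matrix_vector_mult_def vec_eq_iff sum_negf)

lemma inner_mult_sum:
  fixes x :: "real^'a::finite" and y :: "real^'b::finite"
  shows "x \<bullet> (M *v y) = (\<Sum>i\<in>UNIV. \<Sum>j\<in>UNIV. x $ i * (M $ i $ j * y $ j))"
  by (simp add: inner_vec_def matrix_vector_mult_def sum_distrib_left)

lemma quad_stack:
  fixes H :: "('z::finite, 'u::finite, 'd::finite) model"
  shows "quad H (stack z (stack u d)) = sigma H z u d"
  unfolding quad_def sigma_def inner_mult_sum
  by (simp add: block_def sum_sum_type stack_def sum.distrib)

lemma quad_transpose_mult:
  fixes M :: "real^'a::finite^'b::finite"
  shows "quad (transpose M ** P ** M) x = quad P (M *v x)"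
  by (simp add: quad_def matrix_vector_mul_assoc[symmetric] transpose_matrix_vector
      dot_lmul_matrix inner_commute[of x] inner_commute[of "M *v x"])

lemma quad_add: "quad (P + Q) x = quad P x + quad Q x"
  by (simp add: quad_def matrix_vector_mult_add_rdistrib inner_add_right)

lemma quad_diff: "quad (P - Q) x = quad P x - quad Q x"
  by (simp add: quad_def matrix_vector_mult_diff_rdistrib inner_diff_right)

lemma quad_scaleR: "quad (c *\<^sub>R P) x = c * quad P x"
  by (simp add: quad_def scaleR_matrix_vector_assoc[symmetric])

lemma loewner_le_quad: "P \<preceq> Q \<Longrightarrow> quad P x \<le> quad Q x"
  by (auto simp: loewner_le_def pos_semidef_def quad_diff)

lemma quad_pad:
  fixes P :: "real^'z::finite^'z"
  shows "quad (pad P) (stack z (d :: real^'d::finite)) = quad P z"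
  by (simp add: quad_def pad_def vcat_mult hcat_mult_stack inner_stack)

text \<open>
  The left factor of the first term of \<open>lmi_G\<close> produces the successor state under \<open>u = - K z\<close>, and
  that of the second term produces the stacked triple \<open>(z, u, d)\<close>.
\<close>

lemma quad_lmi_G:
  fixes H :: "('z::finite, 'u::finite, 'd::finite) model"
  shows "quad (lmi_G A B G P K H) (stack z d) =
    quad P (A *v z + B *v (- (K *v z)) + G *v d) + sigma H z (- (K *v z)) d"
proof -
  have "(A - B ** K) *v z + G *v d = A *v z + B *v (- (K *v z)) + G *v d"
    by (simp add: matrix_vector_mult_diff_rdistrib matrix_vector_mul_assoc[symmetric]
        matrix_mult_minus)
  then show ?thesis
    by (simp add: lmi_G_def Let_def quad_add quad_transpose_mult hcat_mult_stack vcat_mult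
        matrix_minus_mult quad_stack)
qed

section \<open>One step of the game\<close>

lemma sigma_average:
  "sigma ((1/2) *\<^sub>R (H + H')) z u d = (sigma H z u d + sigma H' z u d) / 2"
  by (simp add: quad_stack[symmetric] quad_scaleR quad_add)

lemma value_approx_ge:
  assumes "i \<in> {1..N}" "j \<in> {1..N}"
  shows "ereal (quad (Q i j) z + (r (H i) + r (H j)) / 2) \<le> value_approx N H Q z r"
  unfolding value_approx_def ereal_less_eq
  by (rule Max_ge) (use assms in force)+

lemma value_approx_le:
  assumes "N \<ge> 1"
    and "\<And>i j. i \<in> {1..N} \<Longrightarrow> j \<in> {1..N} \<Longrightarrow>
      ereal (quad (Q i j) z + (r (H i) + r (H j)) / 2) \<le> c"
  shows "value_approx N H Q z r \<le> c"
proof -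
  let ?S = "(\<lambda>(i, j). quad (Q i j) z + (r (H i) + r (H j)) / 2) ` ({1..N} \<times> {1..N})"
  have "Max ?S \<in> ?S"
    using \<open>N \<ge> 1\<close> by (intro Max_in) auto
  then show ?thesis
    unfolding value_approx_def using assms(2) by auto
qed

lemma value_approx_step:
  fixes H :: "nat \<Rightarrow> ('z::finite, 'u::finite, 'd::finite) model"
  assumes "N \<ge> 1"
    and lmi: "\<And>i j. i \<in> {1..N} \<Longrightarrow> j \<in> {1..N} \<Longrightarrow>
      lmi_G A B G (Q i j) K ((1/2) *\<^sub>R (H i + H j)) \<preceq> pad (Q' i j)"
  shows "bellman_law A B G (\<lambda>z r. - (K *v z)) (value_approx N H Q) z r \<le> value_approx N H Q' z r"
  unfolding bellman_law_def bellman_u_def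
proof (intro SUP_least value_approx_le[OF \<open>N \<ge> 1\<close>])
  fix d i j assume ij: "i \<in> {1..N}" "j \<in> {1..N}"
  let ?u = "- (K *v z)"
  have "quad (Q i j) (A *v z + B *v ?u + G *v d) + (sigma (H i) z ?u d + sigma (H j) z ?u d) / 2
      \<le> quad (Q' i j) z"
    using loewner_le_quad[OF lmi[OF ij], of "stack z d"]
    by (simp add: quad_lmi_G quad_pad sigma_average)
  then have "ereal (quad (Q i j) (A *v z + B *v ?u + G *v d) +
        (info_step r z ?u d (H i) + info_step r z ?u d (H j)) / 2)
      \<le> ereal (quad (Q' i j) z + (r (H i) + r (H j)) / 2)"
    by (simp add: info_step_def field_simps)
  also have "\<dots> \<le> value_approx N H Q' z r"
    by (rule value_approx_ge[OF ij])
  finally show "ereal (quad (Q i j) (A *v z + B *v ?u + G *v d) +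
        (info_step r z ?u d (H i) + info_step r z ?u d (H j)) / 2) \<le> value_approx N H Q' z r" .
qed

lemma bellman_law_mono:
  assumes "\<And>z r. V z r \<le> W z r"
  shows "bellman_law A B G \<eta> V z r \<le> bellman_law A B G \<eta> W z r"
  unfolding bellman_law_def bellman_u_def by (intro SUP_mono') (rule assms)

text \<open>
  The disturbance is the maximiser \<open>d = - (H\<^sup>d\<^sup>d)\<^sup>-\<^sup>1 (H\<^sup>d\<^sup>z z + H\<^sup>d\<^sup>u u)\<close> of the concave function
  \<open>\<sigma>\<^sub>H(z, u, \<cdot>)\<close>; its value there is the quadratic form of the Schur complement.
\<close>

lemma admissible_sigma_nonneg:
  fixes H :: "('z::finite, 'u::finite, 'd::finite) model"
  assumes "admissible_model H"
  obtains d where "0 \<le> sigma H z u d"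
proof -
  define M where "M = block H bld bld"
  define w where "w = block H bld blz *v z + block H bld blu *v u"
  define d where "d = - (matrix_inv M *v w)"
  have "x = 0" if "M *v x = 0" for x
  proof (rule ccontr)
    assume "x \<noteq> 0"
    then have "0 < quad (- M) x"
      using assms by (simp add: admissible_model_def pos_def_def M_def)
    with that show False by (simp add: quad_def matrix_minus_mult)
  qed
  then have "invertible M"
    by (simp add: invertible_left_inverse matrix_left_invertible_ker)
  then have "M ** matrix_inv M = mat 1"
    unfolding invertible_def matrix_inv_def by (rule someI2_ex) simp
  then have Md: "M *v d = - w"
    by (simp add: d_def matrix_mult_minus matrix_vector_mul_assoc)
  have "sigma H z u d = z \<bullet> (block H blz blz *v z) + z \<bullet> (block H blz blu *v u)
      + u \<bullet> (block H blu blz *v z) + u \<bullet> (block H blu blu *v u)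
      + z \<bullet> (block H blz bld *v d) + u \<bullet> (block H blu bld *v d) + d \<bullet> w + d \<bullet> (M *v d)"
    by (simp add: sigma_def w_def M_def inner_add_right)
  also have "\<dots> = quad (schur H) (stack z u)"
    unfolding Md
    by (simp add: quad_def schur_def vcat_mult hcat_mult_stack inner_stack schur_block_def
        matrix_vector_mult_diff_rdistrib matrix_vector_mul_assoc[symmetric] M_def[symmetric]
        d_def w_def matrix_mult_minus matrix_vector_mult_diff_distrib
        matrix_vector_right_distrib inner_add_right inner_diff_right)
  also have "0 \<le> \<dots>"
    using assms by (simp add: admissible_model_def pos_semidef_def)
  finally show ?thesis by (rule that)
qed

section \<open>One period\<close>

text \<open>
  The iterates of the Bellman operator are bounded by value functions of the same maximum form,
  with \<open>Q s\<close> in place of \<open>P\<close>. At the end the pair \<open>(i, j)\<close> is traded for \<open>(j, k)\<close>; a pair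
  \<open>(i, k)\<close> with \<open>i \<noteq> k\<close> is first reordered, so that \<open>Q \<tau> i k\<close> is compared with \<open>P i k\<close> and not
  with \<open>P k k\<close>.
\<close>

lemma bellman_period:
  fixes H :: "nat \<Rightarrow> ('z::finite, 'u::finite, 'd::finite) model"
  assumes "N \<ge> 1" "\<tau> \<ge> 1"
    and best: "best_index N H r k"
    and sym: "\<And>i j. i \<in> {1..N} \<Longrightarrow> j \<in> {1..N} \<Longrightarrow> Q \<tau> i j = Q \<tau> j i"
    and first: "\<And>i j. i \<in> {1..N} \<Longrightarrow> j \<in> {1..N} \<Longrightarrow>
      lmi_G A B G (P i j) K ((1/2) *\<^sub>R (H i + H j)) \<preceq> pad (Q 1 i j)"
    and inner: "\<And>s i j. s \<in> {1..\<tau>-1} \<Longrightarrow> i \<in> {1..N} \<Longrightarrow> j \<in> {1..N} \<Longrightarrow>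
      lmi_G A B G (Q s i j) K ((1/2) *\<^sub>R (H i + H j)) \<preceq> pad (Q (s+1) i j)"
    and last: "\<And>i j. i \<in> {1..N} \<Longrightarrow> j \<in> {1..N} \<Longrightarrow> \<not> (i \<noteq> j \<and> j = k) \<Longrightarrow> Q \<tau> i j \<preceq> P j k"
  shows "(bellman_law A B G (\<lambda>z r. - (K *v z)) ^^ \<tau>) (value_approx N H P) z r
    \<le> value_approx N H P z r"
proof -
  let ?F = "bellman_law A B G (\<lambda>z r. - (K *v z))"
  have iterate: "(?F ^^ Suc s) (value_approx N H P) z r \<le> value_approx N H (Q (Suc s)) z r"
    if "Suc s \<le> \<tau>" for s z r
    using that
  proof (induction s arbitrary: z r)
    case 0
    show ?case using value_approx_step[OF \<open>N \<ge> 1\<close> first] by simp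
  next
    case (Suc s)
    have "(?F ^^ Suc (Suc s)) (value_approx N H P) z r \<le> ?F (value_approx N H (Q (Suc s))) z r"
      unfolding funpow.simps(2)[of "Suc s"] comp_apply
      by (rule bellman_law_mono) (use Suc in simp)
    also have "\<dots> \<le> value_approx N H (Q (Suc (Suc s))) z r"
      using Suc.prems inner[of "Suc s"] by (intro value_approx_step \<open>N \<ge> 1\<close>) auto
    finally show ?case .
  qed
  have k: "k \<in> {1..N}" and kmax: "r (H i) \<le> r (H k)" if "i \<in> {1..N}" for i
    using best that by (auto simp: best_index_def is_arg_max_linorder)
  have trade: "ereal (quad (Q \<tau> i j) z + (r (H i) + r (H j)) / 2) \<le> value_approx N H P z r"
    if ij: "i \<in> {1..N}" "j \<in> {1..N}" and "\<not> (i \<noteq> j \<and> j = k)" for i j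
  proof -
    have "ereal (quad (Q \<tau> i j) z + (r (H i) + r (H j)) / 2)
        \<le> ereal (quad (P j k) z + (r (H j) + r (H k)) / 2)"
      using loewner_le_quad[OF last[OF that], of z] kmax[OF ij(1)] by (simp add: field_simps)
    also have "\<dots> \<le> value_approx N H P z r"
      using ij k by (intro value_approx_ge)
    finally show ?thesis .
  qed
  have "(?F ^^ \<tau>) (value_approx N H P) z r \<le> value_approx N H (Q \<tau>) z r"
    using iterate[of "\<tau> - 1" z r] \<open>\<tau> \<ge> 1\<close> by simp
  also have "\<dots> \<le> value_approx N H P z r"
  proof (rule value_approx_le[OF \<open>N \<ge> 1\<close>])
    fix i j assume ij: "i \<in> {1..N}" "j \<in> {1..N}"
    show "ereal (quad (Q \<tau> i j) z + (r (H i) + r (H j)) / 2) \<le> value_approx N H P z r"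
    proof (cases "i \<noteq> j \<and> j = k")
      case True
      then have "\<not> (j \<noteq> i \<and> i = k)" by simp
      from trade[OF ij(2,1) this] show ?thesis
        by (simp add: sym[OF ij] add.commute)
    qed (use trade[OF ij] in simp)
  qed
  finally show ?thesis .
qed

text \<open>
  Iterated Bellman operators take the supremum over all disturbance sequences, so every single
  trajectory stays below them.
\<close>

lemma trajectory_le_bellman_iterate:
  assumes "\<And>t. t < n \<Longrightarrow>
      z (Suc t) = A *v z t + B *v \<eta> (z t) (r t) + G *v d t \<and>
      r (Suc t) = info_step (r t) (z t) (\<eta> (z t) (r t)) (d t)"
  shows "V (z n) (r n) \<le> (bellman_law A B G \<eta> ^^ n) V (z 0) (r 0)"
  using assms
proof (induction n arbitrary: V)
  case (Suc n)
  have "V (z (Suc n)) (r (Suc n)) \<le> bellman_law A B G \<eta> V (z n) (r n)"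
    using Suc.prems[of n] unfolding bellman_law_def bellman_u_def
    by (auto intro: SUP_upper2)
  also have "\<dots> \<le> (bellman_law A B G \<eta> ^^ n) (bellman_law A B G \<eta> V) (z 0) (r 0)"
    using Suc by simp
  finally show ?case by (simp add: funpow_swap1)
qed simp

section \<open>Closed-loop trajectories\<close>

definition state_at where
  "state_at A B G \<mu> z0 d t = last (fst (history A B G \<mu> z0 d t))"

definition input_at where
  "input_at A B G \<mu> z0 d t =
     (let (zs, us) = history A B G \<mu> z0 d t in \<mu> zs us (map d [0..<t]))"

definition info_at where
  "info_at A B G \<mu> z0 d t =
     (let (zs, us) = history A B G \<mu> z0 d t in info_of zs us (map d [0..<t]))"

lemma history_eq:
  "history A B G \<mu> z0 d t =
     (map (state_at A B G \<mu> z0 d) [0..<Suc t], map (input_at A B G \<mu> z0 d) [0..<t])"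
proof (induction t)
  case 0
  show ?case by (simp add: state_at_def)
next
  case (Suc t)
  have "history A B G \<mu> z0 d (Suc t) =
      (fst (history A B G \<mu> z0 d t) @ [state_at A B G \<mu> z0 d (Suc t)],
       snd (history A B G \<mu> z0 d t) @ [input_at A B G \<mu> z0 d t])"
    by (simp add: state_at_def input_at_def Let_def split: prod.split)
  then show ?case by (simp add: Suc)
qed

lemma state_at_0: "state_at A B G \<mu> z0 d 0 = z0"
  by (simp add: state_at_def)

lemma state_at_Suc:
  "state_at A B G \<mu> z0 d (Suc t) =
     A *v state_at A B G \<mu> z0 d t + B *v input_at A B G \<mu> z0 d t + G *v d t"
  by (simp add: state_at_def input_at_def Let_def split: prod.split)

lemma info_at_eq:
  "info_at A B G \<mu> z0 d t H =
     (\<Sum>s<t. sigma H (state_at A B G \<mu> z0 d s) (input_at A B G \<mu> z0 d s) (d s))"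
  by (simp add: info_at_def info_of_def history_eq nth_append less_Suc_eq del: upt_Suc)

lemma info_at_Suc:
  "info_at A B G \<mu> z0 d (Suc t) =
     info_step (info_at A B G \<mu> z0 d t) (state_at A B G \<mu> z0 d t) (input_at A B G \<mu> z0 d t) (d t)"
  by (simp add: fun_eq_iff info_at_eq info_step_def)

lemma objective_value_le:
  assumes "\<And>H d T. H \<in> \<M> \<Longrightarrow> ereal (info_at A B G \<mu> z0 d T H) \<le> c"
  shows "objective_value A B G \<M> z0 \<mu> \<le> c"
  unfolding objective_value_def
proof (rule SUP_least, clarify)
  fix H d T assume "H \<in> \<M>"
  moreover have "(let (zs, us) = history A B G \<mu> z0 d T
      in ereal (\<Sum>t<T. sigma H (zs ! t) (us ! t) (d t))) = ereal (info_at A B G \<mu> z0 d T H)"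
    by (simp add: info_at_eq history_eq nth_append less_Suc_eq del: upt_Suc)
  ultimately show "(let (zs, us) = history A B G \<mu> z0 d T
      in ereal (\<Sum>t<T. sigma H (zs ! t) (us ! t) (d t))) \<le> c"
    using assms by simp
qed

lemma history_cong:
  assumes "\<And>s. s < t \<Longrightarrow> d s = d' s"
  shows "history A B G \<mu> z0 d t = history A B G \<mu> z0 d' t"
  using assms
proof (induction t)
  case (Suc t)
  then have ds: "map d [0..<t] = map d' [0..<t]" by simp
  show ?case using Suc by (simp add: ds)
qed simp

text \<open>
  By causality, redefining the disturbance at time \<open>T\<close> alters neither the state nor the input at
  that time, so the disturbance can be chosen in response to both.
\<close>

lemma prolong_horizon:
  assumes "admissible_model H"
  shows "\<exists>d'. info_at A B G \<mu> z0 d T H \<le> info_at A B G \<mu> z0 d' (T + n) H"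
proof (induction n)
  case 0
  show ?case by auto
next
  case (Suc n)
  then obtain d' where d': "info_at A B G \<mu> z0 d T H \<le> info_at A B G \<mu> z0 d' (T + n) H"
    by blast
  obtain v where v: "0 \<le> sigma H (state_at A B G \<mu> z0 d' (T + n))
      (input_at A B G \<mu> z0 d' (T + n)) v"
    using admissible_sigma_nonneg[OF assms] by blast
  define e where "e = d'(T + n := v)"
  have hist: "history A B G \<mu> z0 e (T + n) = history A B G \<mu> z0 d' (T + n)"
    by (rule history_cong) (simp add: e_def)
  have ds: "map e [0..<T + n] = map d' [0..<T + n]"
    by (simp add: e_def)
  have "e (T + n) = v"
    by (simp add: e_def)
  then have "info_at A B G \<mu> z0 e (T + Suc n) H \<ge> info_at A B G \<mu> z0 d' (T + n) H"
    using v by (simp add: info_at_Suc info_step_def)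
      (simp add: info_at_def state_at_def input_at_def hist ds)
  with d' show ?case by (blast intro: order_trans)
qed

text \<open>
  The histories at time \<open>n * \<tau> + s\<close>, truncated as the controller does, are exactly those at the
  start \<open>n * \<tau>\<close> of the period. So the gain does not depend on \<open>s\<close>, as the fixed-gain Bellman
  iteration of a period requires.
\<close>

lemma periodic_ce_input:
  fixes K :: "nat \<Rightarrow> real^'z::finite^'u::finite"
    and \<kappa> :: "(real^'z) list \<Rightarrow> (real^'u) list \<Rightarrow> (real^'d::finite) list \<Rightarrow> nat"
  assumes "s < \<tau>"
  defines "\<mu> \<equiv> periodic_ce_controller K \<kappa> \<tau>"
  shows "input_at A B G \<mu> z0 d (n * \<tau> + s) =
    - (K (case history A B G \<mu> z0 d (n * \<tau>) of (zs, us) \<Rightarrow> \<kappa> zs us (map d [0..<n * \<tau>]))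
        *v state_at A B G \<mu> z0 d (n * \<tau> + s))"
proof -
  let ?t = "n * \<tau> + s"
  have start: "length (map d [0..<?t]) div \<tau> * \<tau> = n * \<tau>"
    using \<open>s < \<tau>\<close> by simp
  have "\<mu> zs us (map d [0..<?t]) = - (K (\<kappa> (take (Suc (n * \<tau>)) zs) (take (n * \<tau>) us)
      (take (n * \<tau>) (map d [0..<?t]))) *v last zs)" for zs us
    unfolding \<mu>_def periodic_ce_controller_def Let_def start ..
  then show ?thesis
    by (simp add: input_at_def[of A B G \<mu> z0 d ?t] history_eq take_map take_upt last_map del: upt_Suc)
qed

theorem theorem6:
  fixes A :: "real^'z^'z" and B :: "real^'u^'z" and G :: "real^'d^'z" and z0 :: "real^'z"
    and N \<tau> :: nat
    and H :: "nat \<Rightarrow> ('z::finite, 'u::finite, 'd::finite) model"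
    and Ps :: "nat \<Rightarrow> nat \<Rightarrow> nat \<Rightarrow> nat \<Rightarrow> real^'z^'z"  \<comment> \<open>\<open>Ps s i j k\<close> is $P^s_{ij,k}$\<close>
    and P :: "nat \<Rightarrow> nat \<Rightarrow> real^'z^'z"
    and K :: "nat \<Rightarrow> real^'z^'u"
  assumes "N \<ge> 1"
    and "\<forall>i\<in>{1..N}. admissible_model (H i)"
    and "\<tau> \<ge> 1"
    and "\<forall>s\<in>{1..\<tau>}. \<forall>i\<in>{1..N}. \<forall>j\<in>{1..N}. \<forall>k\<in>{1..N}.
           sym_mat (Ps s i j k) \<and> Ps s i j k = Ps s j i k"
    and "\<forall>i\<in>{1..N}. \<forall>j\<in>{1..N}. pos_semidef (P i j) \<and> P i j = P j i"
    and "\<forall>i\<in>{1..N}. \<forall>j\<in>{1..N}. \<forall>k\<in>{1..N}. \<not> (i \<noteq> j \<and> j = k) \<longrightarrow>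
           Ps \<tau> i j k \<preceq> P j k \<and>
           lmi_G A B G (P i j) (K k) ((1/2) *\<^sub>R (H i + H j)) \<preceq> pad (Ps 1 i j k) \<and>
           (\<forall>s\<in>{1..\<tau>-1}.
              lmi_G A B G (Ps s i j k) (K k) ((1/2) *\<^sub>R (H i + H j)) \<preceq> pad (Ps (s+1) i j k))"
  shows "(\<forall>sel. (\<forall>z r. best_index N H r (sel z r)) \<longrightarrow>
            (\<forall>z r. periodic_bellman A B G K sel \<tau> (value_approx N H P) z r
                     \<le> value_approx N H P z r)) \<and>
         (\<forall>\<kappa>. (\<forall>zs us ds. best_index N H (info_of zs us ds) (\<kappa> zs us ds)) \<longrightarrow>
            objective_value A B G (H ` {1..N}) z0 (periodic_ce_controller K \<kappa> \<tau>)
              \<le> (let r0 = (\<lambda>_. 0)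
                 in ereal (Max {quad Z z0 + (r0 (H i) + r0 (H j)) / 2 | i j Z.
                      i \<in> {1..N} \<and> j \<in> {1..N} \<and>
                      Z \<in> {P i j} \<union> {Ps s i j k | s k. s \<in> {1..\<tau>-1} \<and> k \<in> {1..N}}})))"
proof -
  let ?V = "value_approx N H P"
  note N = \<open>N \<ge> 1\<close> and sym = assms(4) and psd = assms(5) and lmi = assms(6)

  \<comment> \<open>An excluded triple \<open>i \<noteq> j = k\<close> is replaced by the included triple with \<open>i\<close> and \<open>j\<close> swapped.\<close>
  have first: "lmi_G A B G (P i j) (K k) ((1/2) *\<^sub>R (H i + H j)) \<preceq> pad (Ps 1 i j k)"
    and inner: "\<And>s. s \<in> {1..\<tau>-1} \<Longrightarrow>
      lmi_G A B G (Ps s i j k) (K k) ((1/2) *\<^sub>R (H i + H j)) \<preceq> pad (Ps (s+1) i j k)"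
    if ijk: "i \<in> {1..N}" "j \<in> {1..N}" "k \<in> {1..N}" for i j k
  proof -
    obtain a b where ab: "a \<in> {1..N}" "b \<in> {1..N}" "\<not> (a \<noteq> b \<and> b = k)"
        "(a = i \<and> b = j) \<or> (a = j \<and> b = i)"
      using ijk by (cases "i \<noteq> j \<and> j = k") blast+
    have HH: "H a + H b = H i + H j" using ab(4) by (auto simp: add.commute)
    have PP: "P a b = P i j" using ab(4) psd ijk by auto
    have QQ: "Ps s a b k = Ps s i j k" if "s \<in> {1..\<tau>}" for s
      using ab(4) sym ijk that by blast
    note ab_lmi = lmi[rule_format, OF ab(1,2) ijk(3) ab(3)]
    show "lmi_G A B G (P i j) (K k) ((1/2) *\<^sub>R (H i + H j)) \<preceq> pad (Ps 1 i j k)"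
      using ab_lmi QQ[of 1] \<open>\<tau> \<ge> 1\<close> by (simp add: HH PP)
    fix s assume s: "s \<in> {1..\<tau>-1}"
    then have "s \<in> {1..\<tau>}" "s + 1 \<in> {1..\<tau>}" by auto
    then show "lmi_G A B G (Ps s i j k) (K k) ((1/2) *\<^sub>R (H i + H j)) \<preceq> pad (Ps (s+1) i j k)"
      using ab_lmi s QQ[of s] QQ[of "s + 1"] HH by metis
  qed

  have period: "(bellman_law A B G (\<lambda>z r. - (K k *v z)) ^^ \<tau>) ?V z r \<le> ?V z r"
    if best: "best_index N H r k" for k z r
  proof (rule bellman_period[where Q = "\<lambda>s i j. Ps s i j k", OF N \<open>\<tau> \<ge> 1\<close> best])
    have k: "k \<in> {1..N}"
      using best by (simp add: best_index_def is_arg_max_def)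
    fix i j assume ij: "i \<in> {1..N}" "j \<in> {1..N}"
    show "Ps \<tau> i j k = Ps \<tau> j i k"
      using sym ij k \<open>\<tau> \<ge> 1\<close> by auto
    show "lmi_G A B G (P i j) (K k) ((1/2) *\<^sub>R (H i + H j)) \<preceq> pad (Ps 1 i j k)"
      by (rule first[OF ij k])
    show "Ps \<tau> i j k \<preceq> P j k" if "\<not> (i \<noteq> j \<and> j = k)"
      using lmi[rule_format, OF ij k that] by blast
    show "lmi_G A B G (Ps s i j k) (K k) ((1/2) *\<^sub>R (H i + H j)) \<preceq> pad (Ps (s+1) i j k)"
      if "s \<in> {1..\<tau>-1}" for s
      by (rule inner[OF ij k that])
  qed

  have objective: "objective_value A B G (H ` {1..N}) z0 (periodic_ce_controller K \<kappa> \<tau>)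
      \<le> ?V z0 (\<lambda>_. 0)"
    if \<kappa>: "\<forall>zs us ds. best_index N H (info_of zs us ds) (\<kappa> zs us ds)" for \<kappa>
  proof (rule objective_value_le)
    define \<mu> where "\<mu> = periodic_ce_controller K \<kappa> \<tau>"
    let ?z = "state_at A B G \<mu> z0" and ?r = "info_at A B G \<mu> z0"
    have descent: "?V (?z d (n * \<tau>)) (?r d (n * \<tau>)) \<le> ?V z0 (\<lambda>_. 0)" for d n
    proof (induction n)
      case 0
      have "?r d 0 = (\<lambda>_. 0)" by (simp add: fun_eq_iff info_at_eq)
      then show ?case by (simp add: state_at_0)
    next
      case (Suc n)
      define k where
        "k = (case history A B G \<mu> z0 d (n * \<tau>) of (zs, us) \<Rightarrow> \<kappa> zs us (map d [0..<n * \<tau>]))"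
      have best: "best_index N H (?r d (n * \<tau>)) k"
        using \<kappa> by (simp add: k_def info_at_def split: prod.split)
      let ?\<eta> = "\<lambda>z r. - (K k *v z)"
      have "?V (?z d (n * \<tau> + \<tau>)) (?r d (n * \<tau> + \<tau>))
          \<le> (bellman_law A B G ?\<eta> ^^ \<tau>) ?V (?z d (n * \<tau> + 0)) (?r d (n * \<tau> + 0))"
      proof (rule trajectory_le_bellman_iterate[where z = "\<lambda>s. ?z d (n * \<tau> + s)"
            and r = "\<lambda>s. ?r d (n * \<tau> + s)" and d = "\<lambda>s. d (n * \<tau> + s)"])
        fix s assume "s < \<tau>"
        then have "input_at A B G \<mu> z0 d (n * \<tau> + s) = - (K k *v ?z d (n * \<tau> + s))"
          unfolding \<mu>_def k_def by (rule periodic_ce_input)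
        then show "?z d (n * \<tau> + Suc s) = A *v ?z d (n * \<tau> + s) +
              B *v - (K k *v ?z d (n * \<tau> + s)) + G *v d (n * \<tau> + s) \<and>
            ?r d (n * \<tau> + Suc s) = info_step (?r d (n * \<tau> + s)) (?z d (n * \<tau> + s))
              (- (K k *v ?z d (n * \<tau> + s))) (d (n * \<tau> + s))"
          by (simp add: state_at_Suc info_at_Suc)
      qed
      also have "\<dots> \<le> ?V (?z d (n * \<tau>)) (?r d (n * \<tau>))"
        using period[OF best] by simp
      also note Suc
      finally show ?case by (simp add: add.commute)
    qed
    fix M d T assume "M \<in> H ` {1..N}"
    then obtain m where m: "m \<in> {1..N}" "M = H m" by blast
    \<comment> \<open>Any multiple of the period that is at least \<open>T\<close> will do; \<open>T * \<tau>\<close> is one.\<close>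
    then obtain d' where "?r d T M \<le> ?r d' (T + (T * \<tau> - T)) M"
      using prolong_horizon assms(2) by blast
    then have "?r d T M \<le> ?r d' (T * \<tau>) M"
      using \<open>\<tau> \<ge> 1\<close> by simp
    also have "\<dots> \<le> quad (P m m) (?z d' (T * \<tau>)) + (?r d' (T * \<tau>) (H m) + ?r d' (T * \<tau>) (H m)) / 2"
      using psd m by (simp add: pos_semidef_def)
    finally have "ereal (?r d T M) \<le> ereal \<dots>" by simp
    also have "\<dots> \<le> ?V (?z d' (T * \<tau>)) (?r d' (T * \<tau>))"
      using m by (intro value_approx_ge)
    also note descent
    finally show "ereal (info_at A B G (periodic_ce_controller K \<kappa> \<tau>) z0 d T M) \<le> ?V z0 (\<lambda>_. 0)"
      by (simp add: \<mu>_def)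
  qed

  let ?Z = "\<lambda>i j. {P i j} \<union> {Ps s i j k | s k. s \<in> {1..\<tau>-1} \<and> k \<in> {1..N}}"
  let ?S = "{quad Z z0 + (0 + 0) / 2 | i j Z. i \<in> {1..N} \<and> j \<in> {1..N} \<and> Z \<in> ?Z i j}"
  have finite_Z: "finite (?Z i j)" for i j
    using finite_image_set2[of "\<lambda>s. s \<in> {1..\<tau>-1}" "\<lambda>k. k \<in> {1..N}" "\<lambda>s k. Ps s i j k"]
    by (simp only: Collect_mem_eq finite_atLeastAtMost finite_Un finite.intros simp_thms)
  have "finite ?S"
  proof (rule finite_subset)
    show "?S \<subseteq> (\<Union>i\<in>{1..N}. \<Union>j\<in>{1..N}. (\<lambda>Z. quad Z z0) ` ?Z i j)"
      by (simp only: add_0_right div_0) blast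
    show "finite (\<Union>i\<in>{1..N}. \<Union>j\<in>{1..N}. (\<lambda>Z. quad Z z0) ` ?Z i j)"
      by (intro finite_UN_I finite_imageI finite_Z finite_atLeastAtMost)
  qed
  then have "?V z0 (\<lambda>_. 0) \<le> ereal (Max ?S)"
    by (intro value_approx_le[OF N]) (auto intro!: Max_ge)
  with period objective show ?thesis
    unfolding periodic_bellman_def Let_def by (blast intro: order_trans)
qed

end
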